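(* Let $(A,\circ,B,\omega)$ be a quadratic Rota-Baxter pre-Lie algebra of weight $\lambda\neq0$, and let $J_\omega:A^*\to A$ be the linear isomorphism given by $\langle J_\omega^{-1}x,y\rangle=\omega(x,y)$. Let $r^{B,\omega}\in A\otimes A$ be the element determined by $\langle r^{B,\omega},\xi\otimes\eta\rangle=\langle r_+^{B,\omega}(\xi),\eta\rangle$ for all $\xi,\eta\in A^*$, where $r_+^{B,\omega}=\frac1\lambda(B+\lambda\,\mathrm{id})\circ J_\omega:A^*\to A$, and let $\Delta_{r^{B,\omega}}:A\to A\otimes A$, $\Delta_{r^{B,\omega}}(x)=(L_x\otimes\mathrm{id}+\mathrm{id}\otimes(L_x-R_x))r^{B,\omega}$. Let $P:A\to A$ be an averaging operator on $(A,\circ,B,\omega)$. Then $(A,\circ,\Delta_{r^{B,\omega}},P,-P)$ is an averaging pre-Lie bialgebra.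
   Context: All vector spaces are finite-dimensional over a fixed field $\mathbf k$ of characteristic $0$; $\langle\cdot,\cdot\rangle$ is the canonical pairing and $\tau(x\otimes y)=y\otimes x$. A pre-Lie algebra $(A,\circ)$ is a vector space with a bilinear product satisfying $(x\circ y)\circ z-x\circ(y\circ z)=(y\circ x)\circ z-y\circ(x\circ z)$. Write $L_xy=x\circ y$, $R_xy=y\circ x$. An averaging operator on $(A,\circ)$ is a linear $P:A\to A$ with $P(x)\circ P(y)=P(P(x)\circ y)=P(x\circ P(y))$; then $((A,\circ),P)$ is an averaging pre-Lie algebra. A quadratic pre-Lie algebra $((A,\circ),\omega)$ is a pre-Lie algebra with a nondegenerate skew-symmetric bilinear form $\omega$ with $\omega(x\circ y,z)+\omega(y,x\circ z-z\circ x)=0$. A Rota-Baxter operator of weight $\lambda\in\mathbf k$ on $(A,\circ)$ is a linear $B:A\to A$ with $Bx\circ By=B(Bx\circ y+x\circ By+\lambda x\circ y)$. A quadratic Rota-Baxter pre-Lie algebra of weight $\lambda$ is $(A,\circ,B,\omega)$ with $((A,\circ),\omega)$ quadratic, $B$ a Rota-Baxter operator of weight $\lambda$, and $\omega(Bx,y)+\omega(x,By)+\lambda\omega(x,y)=0$. For linear $P:A\to A$, $P^{*,\omega}:A\to A$ is the adjoint defined by $\omega(Pa,b)=\omega(a,P^{*,\omega}b)$. An averaging operator on the quadratic Rota-Baxter pre-Lie algebra $(A,\circ,B,\omega)$ is a linear $P:A\to A$ such that $((A,\circ),P)$ is an averaging pre-Lie algebra and $B\circ P^{*,\omega}=-P\circ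 B$. A pre-Lie coalgebra $(A,\Delta)$ satisfies $(\Delta\otimes\mathrm{id})\Delta-(\mathrm{id}\otimes\Delta)\Delta=(\tau\otimes\mathrm{id})\bigl((\Delta\otimes\mathrm{id})\Delta-(\mathrm{id}\otimes\Delta)\Delta\bigr)$. A pre-Lie bialgebra $(A,\circ,\Delta)$ is a pre-Lie algebra and pre-Lie coalgebra such that for all $x,y$: $\Delta(x\circ y-y\circ x)=(L_x\otimes\mathrm{id}+\mathrm{id}\otimes(L_x-R_x))\Delta(y)-(L_y\otimes\mathrm{id}+\mathrm{id}\otimes(L_y-R_y))\Delta(x)$ and $(\mathrm{id}-\tau)\Delta(x\circ y)=(\mathrm{id}-\tau)\bigl[(\mathrm{id}\otimes R_y)\Delta(x)+(L_x\otimes\mathrm{id}+\mathrm{id}\otimes L_x)\Delta(y)\bigr]$. An averaging pre-Lie coalgebra $((A,\Delta),S)$ is a pre-Lie coalgebra with linear $S:A\to A$ such that $(S\otimes S)\Delta(x)=(S\otimes\mathrm{id})\Delta(S(x))=(\mathrm{id}\otimes S)\Delta(S(x))$. An averaging pre-Lie bialgebra is a quintuple $(A,\circ,\Delta,P,S)$ such that $((A,\circ),P)$ is an averaging pre-Lie algebra, $((A,\Delta),S)$ is an averaging pre-Lie coalgebra, $(A,\circ,\Delta)$ is a pre-Lie bialgebra, and for all $x,y\in A$: $P(x)\circ S(y)=S(P(x)\circ y)=S(x\circ S(y))$; $S(x)\circ P(y)=S(x\circ P(y))=S(S(x)\circ y)$; $(P\otimes S)\Delta(x)=(\mathrm{id}\otimes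 S)\Delta(P(x))=(P\otimes\mathrm{id})\Delta(P(x))$; $(S\otimes P)\Delta(x)=(S\otimes\mathrm{id})\Delta(P(x))=(\mathrm{id}\otimes P)\Delta(P(x))$. *)

theory Defs
  imports Complex_Main "HOL-Library.Function_Algebras"
begin

section \<open>Finite-dimensional vector spaces, duals and tensors\<close>

locale fd_vector_space = vector_space scale
  for scale :: "'k::field_char_0 \<Rightarrow> 'a::ab_group_add \<Rightarrow> 'a" +
  assumes finite_dim: "\<exists>Basis. finite_dimensional_vector_space scale Basis"

definition bilinear_map ::
  "('k::field \<Rightarrow> 'a::ab_group_add \<Rightarrow> 'a) \<Rightarrow> ('k \<Rightarrow> 'b::ab_group_add \<Rightarrow> 'b) \<Rightarrow> ('a \<Rightarrow> 'a \<Rightarrow> 'b) \<Rightarrow> bool"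
where
  "bilinear_map scale scale' f \<longleftrightarrow>
     (\<forall>x. Vector_Spaces.linear scale scale' (\<lambda>y. f x y)) \<and>
     (\<forall>y. Vector_Spaces.linear scale scale' (\<lambda>x. f x y))"

definition dual :: "('k::field \<Rightarrow> 'a::ab_group_add \<Rightarrow> 'a) \<Rightarrow> ('a \<Rightarrow> 'k) set" where
  "dual scale = {\<xi>. Vector_Spaces.linear scale (*) \<xi>}"

text \<open>
  An element \<open>t\<close> of \<open>A \<otimes> A\<close> is represented by the function
  \<open>(\<xi>, \<eta>) \<mapsto> \<langle>t, \<xi> \<otimes> \<eta>\<rangle>\<close> on \<open>A\<^sup>* \<times> A\<^sup>*\<close>, and an element of \<open>A \<otimes> A \<otimes> A\<close>
  by the analogous function of three functionals.  All these functions are extended by 0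
  outside the dual space, so that equality of tensors is equality of functions.
  Since the pairing separates tensors, the span of the pure tensors is \<open>A \<otimes> A\<close>; for
  finite-dimensional \<open>A\<close> it consists of all bilinear functions on the dual (lemma
  \<open>tensor2_iff\<close> below).
\<close>

type_synonym ('a, 'k) tensor2 = "('a \<Rightarrow> 'k) \<Rightarrow> ('a \<Rightarrow> 'k) \<Rightarrow> 'k"
type_synonym ('a, 'k) tensor3 = "('a \<Rightarrow> 'k) \<Rightarrow> ('a \<Rightarrow> 'k) \<Rightarrow> ('a \<Rightarrow> 'k) \<Rightarrow> 'k"

definition scale2 :: "'k::field \<Rightarrow> ('a, 'k) tensor2 \<Rightarrow> ('a, 'k) tensor2" where
  "scale2 c t = (\<lambda>\<xi> \<eta>. c * t \<xi> \<eta>)"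

definition pure2 :: "('k::field \<Rightarrow> 'a::ab_group_add \<Rightarrow> 'a) \<Rightarrow> 'a \<Rightarrow> 'a \<Rightarrow> ('a, 'k) tensor2" where
  "pure2 scale x y = (\<lambda>\<xi> \<eta>. if \<xi> \<in> dual scale \<and> \<eta> \<in> dual scale then \<xi> x * \<eta> y else 0)"

definition tensor2_space :: "('k::field \<Rightarrow> 'a::ab_group_add \<Rightarrow> 'a) \<Rightarrow> ('a, 'k) tensor2 set" where
  "tensor2_space scale = module.span scale2 {pure2 scale x y | x y. True}"

text \<open>
  The map \<open>f \<otimes> g\<close> on \<open>A \<otimes> A\<close>: it satisfies
  \<open>\<langle>(f \<otimes> g) t, \<xi> \<otimes> \<eta>\<rangle> = \<langle>t, f\<^sup>*\<xi> \<otimes> g\<^sup>*\<eta>\<rangle>\<close>.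
\<close>

definition tmap ::
  "('k::field \<Rightarrow> 'a::ab_group_add \<Rightarrow> 'a) \<Rightarrow> ('a \<Rightarrow> 'a) \<Rightarrow> ('a \<Rightarrow> 'a) \<Rightarrow> ('a, 'k) tensor2 \<Rightarrow> ('a, 'k) tensor2"
where
  "tmap scale f g t =
     (\<lambda>\<xi> \<eta>. if \<xi> \<in> dual scale \<and> \<eta> \<in> dual scale then t (\<xi> \<circ> f) (\<eta> \<circ> g) else 0)"

definition flip2 :: "('a, 'k) tensor2 \<Rightarrow> ('a, 'k) tensor2" where
  "flip2 t = (\<lambda>\<xi> \<eta>. t \<eta> \<xi>)"

text \<open>\<open>\<tau> \<otimes> id\<close>:\<close>

definition flip12 :: "('a, 'k) tensor3 \<Rightarrow> ('a, 'k) tensor3" where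
  "flip12 t = (\<lambda>\<xi> \<eta> \<zeta>. t \<eta> \<xi> \<zeta>)"

text \<open>
  The maps \<open>\<Delta> \<otimes> id\<close> and \<open>id \<otimes> \<Delta>\<close> from \<open>A \<otimes> A\<close> to \<open>A \<otimes> A \<otimes> A\<close>.  Note that
  \<open>\<lambda>x. \<Delta> x \<xi> \<eta>\<close> is the functional \<open>\<Delta>\<^sup>*(\<xi> \<otimes> \<eta>)\<close>, which is 0 if \<open>\<xi>\<close> or \<open>\<eta>\<close> is not in the
  dual.
\<close>

definition tmap_left :: "('a \<Rightarrow> ('a, 'k) tensor2) \<Rightarrow> ('a, 'k) tensor2 \<Rightarrow> ('a, 'k) tensor3" where
  "tmap_left \<Delta> t = (\<lambda>\<xi> \<eta> \<zeta>. t (\<lambda>x. \<Delta> x \<xi> \<eta>) \<zeta>)"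

definition tmap_right :: "('a \<Rightarrow> ('a, 'k) tensor2) \<Rightarrow> ('a, 'k) tensor2 \<Rightarrow> ('a, 'k) tensor3" where
  "tmap_right \<Delta> t = (\<lambda>\<xi> \<eta> \<zeta>. t \<xi> (\<lambda>x. \<Delta> x \<eta> \<zeta>))"


section \<open>Pre-Lie algebras\<close>

definition Lmul :: "('a \<Rightarrow> 'a \<Rightarrow> 'a) \<Rightarrow> 'a \<Rightarrow> 'a \<Rightarrow> 'a" where
  "Lmul mul x = (\<lambda>y. mul x y)"

definition Rmul :: "('a \<Rightarrow> 'a \<Rightarrow> 'a) \<Rightarrow> 'a \<Rightarrow> 'a \<Rightarrow> 'a" where
  "Rmul mul x = (\<lambda>y. mul y x)"

locale pre_lie_algebra = fd_vector_space scale
  for scale :: "'k::field_char_0 \<Rightarrow> 'a::ab_group_add \<Rightarrow> 'a"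
    and mul :: "'a \<Rightarrow> 'a \<Rightarrow> 'a" (infixl \<open>\<odot>\<close> 70) +
  assumes mul_bilinear: "bilinear_map scale scale mul"
    and pre_lie: "(x \<odot> y) \<odot> z - x \<odot> (y \<odot> z) = (y \<odot> x) \<odot> z - y \<odot> (x \<odot> z)"

locale averaging_pre_lie_algebra = pre_lie_algebra scale mul
  for scale :: "'k::field_char_0 \<Rightarrow> 'a::ab_group_add \<Rightarrow> 'a"
    and mul :: "'a \<Rightarrow> 'a \<Rightarrow> 'a" (infixl \<open>\<odot>\<close> 70)
    and P :: "'a \<Rightarrow> 'a" +
  assumes P_linear: "Vector_Spaces.linear scale scale P"
    and averaging_left: "P x \<odot> P y = P (P x \<odot> y)"
    and averaging_right: "P x \<odot> P y = P (x \<odot> P y)"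

locale quadratic_pre_lie_algebra = pre_lie_algebra scale mul
  for scale :: "'k::field_char_0 \<Rightarrow> 'a::ab_group_add \<Rightarrow> 'a"
    and mul :: "'a \<Rightarrow> 'a \<Rightarrow> 'a" (infixl \<open>\<odot>\<close> 70)
    and \<omega> :: "'a \<Rightarrow> 'a \<Rightarrow> 'k" +
  assumes form_bilinear: "bilinear_map scale (*) \<omega>"
    and form_skew: "\<omega> x y = - \<omega> y x"
    and form_nondegenerate: "(\<And>y. \<omega> x y = 0) \<Longrightarrow> x = 0"
    and form_invariant: "\<omega> (x \<odot> y) z + \<omega> y (x \<odot> z - z \<odot> x) = 0"

locale rota_baxter_pre_lie_algebra = pre_lie_algebra scale mul
  for scale :: "'k::field_char_0 \<Rightarrow> 'a::ab_group_add \<Rightarrow> 'a"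
    and mul :: "'a \<Rightarrow> 'a \<Rightarrow> 'a" (infixl \<open>\<odot>\<close> 70)
    and B :: "'a \<Rightarrow> 'a"
    and wt :: 'k +
  assumes B_linear: "Vector_Spaces.linear scale scale B"
    and rota_baxter: "B x \<odot> B y = B (B x \<odot> y + x \<odot> B y + scale wt (x \<odot> y))"

locale quadratic_rota_baxter_pre_lie_algebra =
  quadratic_pre_lie_algebra scale mul \<omega> + rota_baxter_pre_lie_algebra scale mul B wt
  for scale :: "'k::field_char_0 \<Rightarrow> 'a::ab_group_add \<Rightarrow> 'a"
    and mul :: "'a \<Rightarrow> 'a \<Rightarrow> 'a" (infixl \<open>\<odot>\<close> 70)
    and B :: "'a \<Rightarrow> 'a"
    and \<omega> :: "'a \<Rightarrow> 'a \<Rightarrow> 'k"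
    and wt :: 'k +
  assumes form_rota_baxter: "\<omega> (B x) y + \<omega> x (B y) + wt * \<omega> x y = 0"

definition form_adjoint :: "('a \<Rightarrow> 'a \<Rightarrow> 'k) \<Rightarrow> ('a \<Rightarrow> 'a) \<Rightarrow> 'a \<Rightarrow> 'a" where
  "form_adjoint \<omega> P b = (THE c. \<forall>a. \<omega> (P a) b = \<omega> a c)"

locale averaging_operator_quadratic_rota_baxter =
  quadratic_rota_baxter_pre_lie_algebra scale mul B \<omega> wt + averaging_pre_lie_algebra scale mul P
  for scale :: "'k::field_char_0 \<Rightarrow> 'a::ab_group_add \<Rightarrow> 'a"
    and mul :: "'a \<Rightarrow> 'a \<Rightarrow> 'a" (infixl \<open>\<odot>\<close> 70)
    and B :: "'a \<Rightarrow> 'a"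
    and \<omega> :: "'a \<Rightarrow> 'a \<Rightarrow> 'k"
    and wt :: 'k
    and P :: "'a \<Rightarrow> 'a" +
  assumes B_adjoint: "B \<circ> form_adjoint \<omega> P = - (P \<circ> B)"


section \<open>Pre-Lie coalgebras and bialgebras\<close>

locale pre_lie_coalgebra = fd_vector_space scale
  for scale :: "'k::field_char_0 \<Rightarrow> 'a::ab_group_add \<Rightarrow> 'a"
    and \<Delta> :: "'a \<Rightarrow> ('a, 'k) tensor2" +
  assumes Delta_tensor: "\<Delta> x \<in> tensor2_space scale"
    and Delta_linear: "Vector_Spaces.linear scale scale2 \<Delta>"
    and co_pre_lie:
      "tmap_left \<Delta> (\<Delta> x) - tmap_right \<Delta> (\<Delta> x) =
       flip12 (tmap_left \<Delta> (\<Delta> x) - tmap_right \<Delta> (\<Delta> x))"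

locale averaging_pre_lie_coalgebra = pre_lie_coalgebra scale \<Delta>
  for scale :: "'k::field_char_0 \<Rightarrow> 'a::ab_group_add \<Rightarrow> 'a"
    and \<Delta> :: "'a \<Rightarrow> ('a, 'k) tensor2"
    and S :: "'a \<Rightarrow> 'a" +
  assumes S_linear: "Vector_Spaces.linear scale scale S"
    and co_averaging_left: "tmap scale S S (\<Delta> x) = tmap scale S id (\<Delta> (S x))"
    and co_averaging_right: "tmap scale S S (\<Delta> x) = tmap scale id S (\<Delta> (S x))"

locale pre_lie_bialgebra = pre_lie_algebra scale mul + pre_lie_coalgebra scale \<Delta>
  for scale :: "'k::field_char_0 \<Rightarrow> 'a::ab_group_add \<Rightarrow> 'a"
    and mul :: "'a \<Rightarrow> 'a \<Rightarrow> 'a" (infixl \<open>\<odot>\<close> 70)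
    and \<Delta> :: "'a \<Rightarrow> ('a, 'k) tensor2" +
  assumes bialgebra_commutator:
      "\<Delta> (x \<odot> y - y \<odot> x) =
         (tmap scale (Lmul mul x) id (\<Delta> y) + tmap scale id (Lmul mul x - Rmul mul x) (\<Delta> y))
       - (tmap scale (Lmul mul y) id (\<Delta> x) + tmap scale id (Lmul mul y - Rmul mul y) (\<Delta> x))"
    and bialgebra_product:
      "\<Delta> (x \<odot> y) - flip2 (\<Delta> (x \<odot> y)) =
       (let t = tmap scale id (Rmul mul y) (\<Delta> x)
              + (tmap scale (Lmul mul x) id (\<Delta> y) + tmap scale id (Lmul mul x) (\<Delta> y))
        in t - flip2 t)"

locale averaging_pre_lie_bialgebra =
  averaging_pre_lie_algebra scale mul P + averaging_pre_lie_coalgebra scale \<Delta> S +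
  pre_lie_bialgebra scale mul \<Delta>
  for scale :: "'k::field_char_0 \<Rightarrow> 'a::ab_group_add \<Rightarrow> 'a"
    and mul :: "'a \<Rightarrow> 'a \<Rightarrow> 'a" (infixl \<open>\<odot>\<close> 70)
    and \<Delta> :: "'a \<Rightarrow> ('a, 'k) tensor2"
    and P :: "'a \<Rightarrow> 'a"
    and S :: "'a \<Rightarrow> 'a" +
  assumes PS_1: "P x \<odot> S y = S (P x \<odot> y)"
    and PS_2: "S (P x \<odot> y) = S (x \<odot> S y)"
    and SP_1: "S x \<odot> P y = S (x \<odot> P y)"
    and SP_2: "S (x \<odot> P y) = S (S x \<odot> y)"
    and co_PS_1: "tmap scale P S (\<Delta> x) = tmap scale id S (\<Delta> (P x))"
    and co_PS_2: "tmap scale id S (\<Delta> (P x)) = tmap scale P id (\<Delta> (P x))"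
    and co_SP_1: "tmap scale S P (\<Delta> x) = tmap scale S id (\<Delta> (P x))"
    and co_SP_2: "tmap scale S id (\<Delta> (P x)) = tmap scale id P (\<Delta> (P x))"


section \<open>The coproduct of a quadratic Rota-Baxter pre-Lie algebra\<close>

text \<open>
  As a curried function, \<open>\<omega>\<close> sends \<open>x\<close> to the functional \<open>\<omega>(x, -)\<close>, so
  \<open>J\<^sub>\<omega>\<^sup>-\<^sup>1\<close> is \<open>\<omega>\<close> itself.  It is injective with range \<open>dual scale\<close> (lemma
  \<open>form_bij_dual\<close> below), so \<open>inv \<omega>\<close> is its inverse on the dual space.
\<close>

definition J_form :: "('a \<Rightarrow> 'a \<Rightarrow> 'k) \<Rightarrow> ('a \<Rightarrow> 'k) \<Rightarrow> 'a" where
  "J_form \<omega> = inv \<omega>"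

definition r_plus ::
  "('k::field \<Rightarrow> 'a::ab_group_add \<Rightarrow> 'a) \<Rightarrow> ('a \<Rightarrow> 'a) \<Rightarrow> ('a \<Rightarrow> 'a \<Rightarrow> 'k) \<Rightarrow> 'k \<Rightarrow> ('a \<Rightarrow> 'k) \<Rightarrow> 'a"
where
  "r_plus scale B \<omega> wt \<xi> = scale (1 / wt) (B (J_form \<omega> \<xi>) + scale wt (J_form \<omega> \<xi>))"

definition r_form ::
  "('k::field \<Rightarrow> 'a::ab_group_add \<Rightarrow> 'a) \<Rightarrow> ('a \<Rightarrow> 'a) \<Rightarrow> ('a \<Rightarrow> 'a \<Rightarrow> 'k) \<Rightarrow> 'k \<Rightarrow> ('a, 'k) tensor2"
where
  "r_form scale B \<omega> wt =
     (\<lambda>\<xi> \<eta>. if \<xi> \<in> dual scale \<and> \<eta> \<in> dual scale then \<eta> (r_plus scale B \<omega> wt \<xi>) else 0)"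

definition coboundary ::
  "('k::field \<Rightarrow> 'a::ab_group_add \<Rightarrow> 'a) \<Rightarrow> ('a \<Rightarrow> 'a \<Rightarrow> 'a) \<Rightarrow> ('a, 'k) tensor2 \<Rightarrow> 'a \<Rightarrow> ('a, 'k) tensor2"
where
  "coboundary scale mul r x =
     tmap scale (Lmul mul x) id r + tmap scale id (Lmul mul x - Rmul mul x) r"


section \<open>Adequacy of the encodings\<close>

lemma vector_space_field: "vector_space ((*) :: 'k::field \<Rightarrow> 'k \<Rightarrow> 'k)"
  by unfold_locales (simp_all add: algebra_simps)

lemma vector_space_scale2:
  "vector_space (scale2 :: 'k::field \<Rightarrow> ('a, 'k) tensor2 \<Rightarrow> ('a, 'k) tensor2)"
  by unfold_locales (simp_all add: scale2_def fun_eq_iff algebra_simps)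

definition bilinear_on_dual :: "('k::field \<Rightarrow> 'a::ab_group_add \<Rightarrow> 'a) \<Rightarrow> ('a, 'k) tensor2 \<Rightarrow> bool" where
  "bilinear_on_dual scale t \<longleftrightarrow>
     (\<forall>\<xi> \<eta>. \<xi> \<notin> dual scale \<or> \<eta> \<notin> dual scale \<longrightarrow> t \<xi> \<eta> = 0) \<and>
     (\<forall>\<xi>\<in>dual scale. \<forall>\<xi>'\<in>dual scale. \<forall>\<eta>\<in>dual scale.
        t (\<xi> + \<xi>') \<eta> = t \<xi> \<eta> + t \<xi>' \<eta> \<and> t \<eta> (\<xi> + \<xi>') = t \<eta> \<xi> + t \<eta> \<xi>') \<and>
     (\<forall>c. \<forall>\<xi>\<in>dual scale. \<forall>\<eta>\<in>dual scale.
        t (\<lambda>x. c * \<xi> x) \<eta> = c * t \<xi> \<eta> \<and> t \<eta> (\<lambda>x. c * \<xi> x) = c * t \<eta> \<xi>)"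

context fd_vector_space
begin

lemma dual_iff:
  "\<xi> \<in> dual scale \<longleftrightarrow> (\<forall>x y. \<xi> (x + y) = \<xi> x + \<xi> y) \<and> (\<forall>c x. \<xi> (scale c x) = c * \<xi> x)"
  unfolding dual_def
  using vector_space_axioms vector_space_field by (auto simp: Vector_Spaces.linear_iff)

lemma dual_zero: "(\<lambda>_. 0) \<in> dual scale"
  and dual_add: "\<xi> \<in> dual scale \<Longrightarrow> \<eta> \<in> dual scale \<Longrightarrow> \<xi> + \<eta> \<in> dual scale"
  and dual_scale: "\<xi> \<in> dual scale \<Longrightarrow> (\<lambda>x. c * \<xi> x) \<in> dual scale"
  by (simp_all add: dual_iff algebra_simps)

lemma dual_sum:
  assumes "\<xi> \<in> dual scale"
  shows "\<xi> (\<Sum>i\<in>I. f i) = (\<Sum>i\<in>I. \<xi> (f i))"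
proof -
  have add: "\<xi> (x + y) = \<xi> x + \<xi> y" and sc: "\<xi> (scale c x) = c * \<xi> x" for x y c
    using assms by (auto simp: dual_iff)
  have "\<xi> 0 = 0"
    using add[of 0 0] by simp
  then show ?thesis
    by (induction I rule: infinite_finite_induct) (simp_all add: add)
qed

lemma dual_compose:
  assumes "\<xi> \<in> dual scale" and "Vector_Spaces.linear scale scale f"
  shows "\<xi> \<circ> f \<in> dual scale"
  using assms by (simp add: dual_iff Vector_Spaces.linear_iff)

lemma dual_coordinates:
  obtains Basis e where
    "finite_dimensional_vector_space scale Basis"
    "\<And>b. e b \<in> dual scale"
    "\<And>x. (\<Sum>b\<in>Basis. scale (e b x) b) = x"
    "\<And>\<xi> x. \<xi> \<in> dual scale \<Longrightarrow> (\<Sum>b\<in>Basis. \<xi> b * e b x) = \<xi> x"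
proof -
  obtain Basis where fd: "finite_dimensional_vector_space scale Basis"
    using finite_dim by blast
  interpret fd: finite_dimensional_vector_space scale Basis by (rule fd)
  define e where "e = (\<lambda>b x. representation Basis x b)"
  have sp: "x \<in> span Basis" for x
    using fd.span_Basis by simp
  have e: "e b \<in> dual scale" for b
    unfolding dual_iff e_def
    by (simp add: representation_add representation_scale fd.independent_Basis sp)
  have ex: "(\<Sum>b\<in>Basis. scale (e b x) b) = x" for x
    unfolding e_def
    by (rule sum_representation_eq) (use fd.independent_Basis fd.finite_Basis sp in auto)
  have xi: "(\<Sum>b\<in>Basis. \<xi> b * e b x) = \<xi> x" if "\<xi> \<in> dual scale" for \<xi> x
  proof -
    have "\<xi> x = \<xi> (\<Sum>b\<in>Basis. scale (e b x) b)" by (simp add: ex)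
    also have "\<dots> = (\<Sum>b\<in>Basis. \<xi> b * e b x)"
      using that by (simp add: dual_sum dual_iff mult.commute)
    finally show ?thesis by simp
  qed
  show ?thesis
    by (rule that[OF fd e ex xi])
qed

lemma bilinear_on_dual_sum:
  assumes t: "bilinear_on_dual scale t" and I: "finite I"
    and f: "\<And>i. i \<in> I \<Longrightarrow> f i \<in> dual scale" and \<eta>: "\<eta> \<in> dual scale"
  shows "(\<lambda>x. \<Sum>i\<in>I. c i * f i x) \<in> dual scale"
    and "t (\<lambda>x. \<Sum>i\<in>I. c i * f i x) \<eta> = (\<Sum>i\<in>I. c i * t (f i) \<eta>)"
    and "t \<eta> (\<lambda>x. \<Sum>i\<in>I. c i * f i x) = (\<Sum>i\<in>I. c i * t \<eta> (f i))"
proof -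
  have "(\<lambda>x. \<Sum>i\<in>I. c i * f i x) \<in> dual scale \<and>
        t (\<lambda>x. \<Sum>i\<in>I. c i * f i x) \<eta> = (\<Sum>i\<in>I. c i * t (f i) \<eta>) \<and>
        t \<eta> (\<lambda>x. \<Sum>i\<in>I. c i * f i x) = (\<Sum>i\<in>I. c i * t \<eta> (f i))"
    using I f
  proof (induction I rule: finite_induct)
    case empty
    have "t (\<lambda>x. 0 * \<eta> x) \<eta> = 0 * t \<eta> \<eta>" "t \<eta> (\<lambda>x. 0 * \<eta> x) = 0 * t \<eta> \<eta>"
      using t \<eta> unfolding bilinear_on_dual_def by blast+
    then show ?case by (simp add: dual_zero)
  next
    case (insert i I)
    define g where "g = (\<lambda>x. \<Sum>i\<in>I. c i * f i x)"
    define h where "h = (\<lambda>x. c i * f i x)"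
    have g: "g \<in> dual scale" "t g \<eta> = (\<Sum>i\<in>I. c i * t (f i) \<eta>)" "t \<eta> g = (\<Sum>i\<in>I. c i * t \<eta> (f i))"
      using insert by (simp_all add: g_def)
    have h: "h \<in> dual scale" using insert.prems by (simp add: h_def dual_scale)
    have fi: "f i \<in> dual scale" using insert.prems by simp
    have ht: "t h \<eta> = c i * t (f i) \<eta>" "t \<eta> h = c i * t \<eta> (f i)"
      using t \<eta> fi unfolding bilinear_on_dual_def h_def by blast+
    have "(\<lambda>x. \<Sum>i\<in>insert i I. c i * f i x) = h + g"
      using insert.hyps by (simp add: g_def h_def fun_eq_iff)
    moreover have "t (h + g) \<eta> = t h \<eta> + t g \<eta>" "t \<eta> (h + g) = t \<eta> h + t \<eta> g"
      using t \<eta> h g(1) unfolding bilinear_on_dual_def by blast+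
    ultimately show ?case
      using insert.hyps by (simp add: dual_add[OF h g(1)] g ht)
  qed
  then show "(\<lambda>x. \<Sum>i\<in>I. c i * f i x) \<in> dual scale"
    and "t (\<lambda>x. \<Sum>i\<in>I. c i * f i x) \<eta> = (\<Sum>i\<in>I. c i * t (f i) \<eta>)"
    and "t \<eta> (\<lambda>x. \<Sum>i\<in>I. c i * f i x) = (\<Sum>i\<in>I. c i * t \<eta> (f i))"
    by auto
qed

lemma tensor2_iff: "t \<in> tensor2_space scale \<longleftrightarrow> bilinear_on_dual scale t"
proof
  interpret T: vector_space "scale2 :: 'k \<Rightarrow> ('a, 'k) tensor2 \<Rightarrow> _"
    by (rule vector_space_scale2)
  show "bilinear_on_dual scale t" if "t \<in> tensor2_space scale"
    using that unfolding tensor2_space_def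
  proof (induction rule: T.span_induct_alt)
    case base
    show ?case by (simp add: bilinear_on_dual_def)
  next
    case (step c p q)
    then obtain x y where p: "p = pure2 scale x y" by blast
    have "bilinear_on_dual scale p"
      unfolding p bilinear_on_dual_def pure2_def
      by (simp add: dual_add dual_scale algebra_simps)
    then show ?case
      using step.IH unfolding bilinear_on_dual_def
      by (simp add: scale2_def algebra_simps)
  qed
  show "t \<in> tensor2_space scale" if t: "bilinear_on_dual scale t"
  proof -
    obtain Basis e where fd: "finite_dimensional_vector_space scale Basis"
      and e: "\<And>b. e b \<in> dual scale"
      and xi: "\<And>\<xi> x. \<xi> \<in> dual scale \<Longrightarrow> (\<Sum>b\<in>Basis. \<xi> b * e b x) = \<xi> x"
      using dual_coordinates by metis
    have fin: "finite Basis"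
      by (rule finite_dimensional_vector_space.finite_Basis[OF fd])
    let ?s = "\<Sum>b\<in>Basis. \<Sum>c\<in>Basis. scale2 (t (e b) (e c)) (pure2 scale b c)"
    have app: "(\<Sum>i\<in>I. F i) \<xi> \<eta> = (\<Sum>i\<in>I. F i \<xi> \<eta>)"
      for F :: "'i \<Rightarrow> ('a, 'k) tensor2" and I \<xi> \<eta>
      by (induction I rule: infinite_finite_induct) simp_all
    have "t \<xi> \<eta> = ?s \<xi> \<eta>" for \<xi> \<eta>
    proof (cases "\<xi> \<in> dual scale \<and> \<eta> \<in> dual scale")
      case True
      then have \<xi>: "\<xi> \<in> dual scale" and \<eta>: "\<eta> \<in> dual scale" by auto
      have "t \<xi> \<eta> = t (\<lambda>x. \<Sum>b\<in>Basis. \<xi> b * e b x) \<eta>"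
        using xi[OF \<xi>] by simp
      also have "\<dots> = (\<Sum>b\<in>Basis. \<xi> b * t (e b) \<eta>)"
        by (rule bilinear_on_dual_sum(2)[OF t fin e \<eta>])
      also have "\<dots> = (\<Sum>b\<in>Basis. \<xi> b * t (e b) (\<lambda>x. \<Sum>c\<in>Basis. \<eta> c * e c x))"
        using xi[OF \<eta>] by simp
      also have "\<dots> = (\<Sum>b\<in>Basis. \<xi> b * (\<Sum>c\<in>Basis. \<eta> c * t (e b) (e c)))"
        using bilinear_on_dual_sum(3)[OF t fin e e] by simp
      also have "\<dots> = ?s \<xi> \<eta>"
        using \<xi> \<eta> by (simp add: app scale2_def pure2_def sum_distrib_left algebra_simps)
      finally show ?thesis .
    next
      case False
      then have "t \<xi> \<eta> = 0" using t by (auto simp: bilinear_on_dual_def)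
      moreover have "?s \<xi> \<eta> = 0" using False by (auto simp: app scale2_def pure2_def)
      ultimately show ?thesis by simp
    qed
    then have "t = ?s" by (intro ext)
    moreover have "?s \<in> tensor2_space scale"
      unfolding tensor2_space_def
      by (intro T.span_sum T.span_scale T.span_base) blast
    ultimately show ?thesis by simp
  qed
qed

lemma tmap_pure:
  assumes "Vector_Spaces.linear scale scale f" and "Vector_Spaces.linear scale scale g"
  shows "tmap scale f g (pure2 scale x y) = pure2 scale (f x) (g y)"
  using assms by (auto simp: tmap_def pure2_def fun_eq_iff dual_compose)

lemma flip2_pure: "flip2 (pure2 scale x y) = pure2 scale y x"
  by (auto simp: flip2_def pure2_def fun_eq_iff)

lemma coproduct_functional:
  assumes "\<And>x. \<Delta> x \<in> tensor2_space scale" and "Vector_Spaces.linear scale scale2 \<Delta>"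
  shows "(\<lambda>x. \<Delta> x \<xi> \<eta>) \<in> dual scale"
  using assms by (simp add: dual_iff Vector_Spaces.linear_iff scale2_def)

text \<open>On pure tensors, \<open>(\<Delta> \<otimes> id)(x \<otimes> y) = \<Delta> x \<otimes> y\<close> and \<open>(id \<otimes> \<Delta>)(x \<otimes> y) = x \<otimes> \<Delta> y\<close>:\<close>

lemma tmap_left_pure:
  assumes "\<And>x. \<Delta> x \<in> tensor2_space scale" and "Vector_Spaces.linear scale scale2 \<Delta>"
  shows "tmap_left \<Delta> (pure2 scale x y) \<xi> \<eta> \<zeta> = (if \<zeta> \<in> dual scale then \<Delta> x \<xi> \<eta> * \<zeta> y else 0)"
  using coproduct_functional[OF assms] by (simp add: tmap_left_def pure2_def)

lemma tmap_right_pure: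
  assumes "\<And>x. \<Delta> x \<in> tensor2_space scale" and "Vector_Spaces.linear scale scale2 \<Delta>"
  shows "tmap_right \<Delta> (pure2 scale x y) \<xi> \<eta> \<zeta> = (if \<xi> \<in> dual scale then \<xi> x * \<Delta> y \<eta> \<zeta> else 0)"
  using coproduct_functional[OF assms] by (simp add: tmap_right_def pure2_def)

end

context quadratic_pre_lie_algebra
begin

lemma form_add_left: "\<omega> (x + y) z = \<omega> x z + \<omega> y z"
  and form_scale_left: "\<omega> (scale c x) z = c * \<omega> x z"
  and form_in_dual: "\<omega> x \<in> dual scale"
  using form_bilinear by (simp_all add: bilinear_map_def dual_def Vector_Spaces.linear_iff)

lemma form_bij_dual: "bij_betw \<omega> UNIV (dual scale)"
proof (rule bij_betw_imageI)
  show inj: "inj \<omega>"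
  proof (rule injI)
    fix x y assume eq: "\<omega> x = \<omega> y"
    have "\<omega> (x + scale (- 1) y) z = 0" for z
      using eq by (simp only: form_add_left form_scale_left) simp
    then have "x + scale (- 1) y = 0" by (rule form_nondegenerate)
    then show "x = y" by simp
  qed
  show "\<omega> ` UNIV = dual scale"
  proof (intro equalityI subsetI)
    fix \<xi> assume "\<xi> \<in> \<omega> ` UNIV"
    then show "\<xi> \<in> dual scale" using form_in_dual by auto
  next
    fix \<xi> assume \<xi>: "\<xi> \<in> dual scale"
    obtain Basis e where fd: "finite_dimensional_vector_space scale Basis"
      and xi: "\<And>\<xi> x. \<xi> \<in> dual scale \<Longrightarrow> (\<Sum>b\<in>Basis. \<xi> b * e b x) = \<xi> x"
      using dual_coordinates by metis
    interpret fd: finite_dimensional_vector_space scale Basis by (rule fd)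
    interpret fdp: finite_dimensional_vector_space_pair scale Basis scale Basis by unfold_locales
    define \<phi> where "\<phi> = (\<lambda>x. \<Sum>b\<in>Basis. scale (\<omega> x b) b)"
    have coeff: "\<forall>b\<in>Basis. u b = v b"
      if "(\<Sum>b\<in>Basis. scale (u b) b) = (\<Sum>b\<in>Basis. scale (v b) b)" for u v :: "'a \<Rightarrow> 'k"
    proof
      fix b assume b: "b \<in> Basis"
      have "(\<Sum>b\<in>Basis. scale (u b - v b) b) = 0"
        using that by (simp add: scale_left_diff_distrib sum_subtractf)
      from independentD[OF fd.independent_Basis fd.finite_Basis subset_refl this b]
      show "u b = v b" by simp
    qed
    have ext: "f = g" if "f \<in> dual scale" "g \<in> dual scale" "\<forall>b\<in>Basis. f b = g b" for f g
    proof
      fix x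
      have "f x = (\<Sum>b\<in>Basis. f b * e b x)" using xi[OF that(1)] by simp
      also have "\<dots> = (\<Sum>b\<in>Basis. g b * e b x)" using that(3) by simp
      finally show "f x = g x" using xi[OF that(2)] by simp
    qed
    have "Vector_Spaces.linear scale scale \<phi>"
      using vector_space_axioms
      by (simp add: Vector_Spaces.linear_iff \<phi>_def form_add_left form_scale_left
          scale_left_distrib sum.distrib scale_sum_right)
    moreover have "inj \<phi>"
    proof (rule injI)
      fix x y assume "\<phi> x = \<phi> y"
      then have "\<forall>b\<in>Basis. \<omega> x b = \<omega> y b" unfolding \<phi>_def by (rule coeff)
      then have "\<omega> x = \<omega> y" by (rule ext[OF form_in_dual form_in_dual])
      then show "x = y" using inj by (simp add: inj_eq)
    qed
    ultimately have "surj \<phi>"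
      by (rule fdp.linear_injective_imp_surjective) simp
    then obtain x where "\<phi> x = (\<Sum>b\<in>Basis. scale (\<xi> b) b)" by (metis surjD)
    then have "\<forall>b\<in>Basis. \<omega> x b = \<xi> b" unfolding \<phi>_def by (rule coeff)
    then have "\<omega> x = \<xi>" by (rule ext[OF form_in_dual \<xi>])
    then show "\<xi> \<in> \<omega> ` UNIV" by blast
  qed
qed

lemma J_form: "\<xi> \<in> dual scale \<Longrightarrow> \<omega> (J_form \<omega> \<xi>) = \<xi>"
  and J_form_form: "J_form \<omega> (\<omega> x) = x"
  using form_bij_dual unfolding J_form_def bij_betw_def
  by (auto simp: f_inv_into_f)

lemma form_adjoint:
  assumes "Vector_Spaces.linear scale scale P"
  shows "\<omega> (P a) b = \<omega> a (form_adjoint \<omega> P b)"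
proof -
  have "(\<lambda>a. \<omega> b (P a)) \<in> dual scale"
    using dual_compose[OF form_in_dual[of b] assms] by (simp add: comp_def)
  then obtain c where c: "\<omega> c = (\<lambda>a. \<omega> b (P a))" using J_form by blast
  have "\<forall>a. \<omega> (P a) b = \<omega> a c"
    using c form_skew by (metis (full_types))
  moreover have "c' = c" if "\<forall>a. \<omega> (P a) b = \<omega> a c'" for c'
  proof -
    have "\<omega> c' = \<omega> c"
      using that c form_skew by (metis (no_types, lifting) ext)
    then show ?thesis using J_form_form by metis
  qed
  ultimately have "\<forall>a. \<omega> (P a) b = \<omega> a (form_adjoint \<omega> P b)"
    unfolding form_adjoint_def by (rule theI)
  then show ?thesis by blast
qed

end

context quadratic_rota_baxter_pre_lie_algebra
begin

lemma r_form_tensor: "r_form scale B \<omega> wt \<in> tensor2_space scale"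
proof -
  have J_add: "J_form \<omega> (\<xi> + \<eta>) = J_form \<omega> \<xi> + J_form \<omega> \<eta>"
    if "\<xi> \<in> dual scale" "\<eta> \<in> dual scale" for \<xi> \<eta>
  proof -
    have "\<omega> (J_form \<omega> \<xi> + J_form \<omega> \<eta>) = \<xi> + \<eta>"
      using that by (simp add: fun_eq_iff form_add_left J_form)
    then show ?thesis using J_form_form by metis
  qed
  have J_scale: "J_form \<omega> (\<lambda>x. c * \<xi> x) = scale c (J_form \<omega> \<xi>)" if "\<xi> \<in> dual scale" for \<xi> c
  proof -
    have "\<omega> (scale c (J_form \<omega> \<xi>)) = (\<lambda>x. c * \<xi> x)"
      using that by (simp add: fun_eq_iff form_scale_left J_form)
    then show ?thesis using J_form_form by metis
  qed
  have B: "B (x + y) = B x + B y" "B (scale c x) = scale c (B x)" for x y c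
    using B_linear by (simp_all add: Vector_Spaces.linear_iff)
  show ?thesis
    unfolding tensor2_iff bilinear_on_dual_def r_form_def
    by (simp add: dual_add dual_scale r_plus_def J_add J_scale B)
       (simp add: dual_iff algebra_simps)
qed

end

end

theory Submission
  imports Defs
begin

text \<open>
  Identify \<open>A\<^sup>*\<close> with \<open>A\<close> through \<open>\<omega>\<close> and put \<open>Q = (B + \<lambda> id) / \<lambda>\<close>, a Rota-Baxter operator of
  weight \<open>-1\<close> whose adjoint is \<open>id - Q\<close>.  The product on \<open>A\<close> dual to the coproduct is then the
  descendent product \<open>a \<star> b = Q a \<odot> b + a \<odot> Q b - a \<odot> b\<close>, so that the coalgebra axiom says that
  \<open>\<star>\<close> is pre-Lie; the first bialgebra axiom is the cocycle identity of a coboundary, and the second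
  one follows from invariance of \<open>\<omega>\<close> and the Jacobi identity.  Taking adjoints in
  \<open>B P\<^sup>*\<^sup>,\<^sup>\<omega> = - P B\<close> gives \<open>P\<^sup>*\<^sup>,\<^sup>\<omega> = - P\<close>, hence \<open>B P = P B\<close>, and skewness of \<open>P\<close> together
  with invariance of \<open>\<omega>\<close> forces \<open>P x \<odot> P y = 0\<close>, whence both sides of every averaging condition
  vanish.
\<close>

section \<open>Calculus of tensors as bilinear functions on the dual\<close>

context fd_vector_space
begin

lemma tensor2_eqI:
  assumes "\<And>\<xi> \<eta>. \<xi> \<notin> dual scale \<or> \<eta> \<notin> dual scale \<Longrightarrow> s \<xi> \<eta> = t \<xi> \<eta>"
    and "\<And>\<xi> \<eta>. \<xi> \<in> dual scale \<Longrightarrow> \<eta> \<in> dual scale \<Longrightarrow> s \<xi> \<eta> = t \<xi> \<eta>"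
  shows "s = (t :: ('a, 'k) tensor2)"
  using assms by (intro ext) blast

lemma tensor2_outside:
  "t \<in> tensor2_space scale \<Longrightarrow> \<xi> \<notin> dual scale \<or> \<eta> \<notin> dual scale \<Longrightarrow> t \<xi> \<eta> = 0"
  unfolding tensor2_iff bilinear_on_dual_def by blast

lemma tensor2_add:
  assumes "t \<in> tensor2_space scale" "\<xi> \<in> dual scale" "\<xi>' \<in> dual scale" "\<eta> \<in> dual scale"
  shows "t (\<xi> + \<xi>') \<eta> = t \<xi> \<eta> + t \<xi>' \<eta>" "t \<eta> (\<xi> + \<xi>') = t \<eta> \<xi> + t \<eta> \<xi>'"
  using assms unfolding tensor2_iff bilinear_on_dual_def by blast+

lemma tensor2_scale:
  assumes "t \<in> tensor2_space scale" "\<xi> \<in> dual scale" "\<eta> \<in> dual scale"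
  shows "t (\<lambda>x. c * \<xi> x) \<eta> = c * t \<xi> \<eta>" "t \<eta> (\<lambda>x. c * \<xi> x) = c * t \<eta> \<xi>"
  using assms unfolding tensor2_iff bilinear_on_dual_def by blast+

lemma dual_diff: "\<xi> \<in> dual scale \<Longrightarrow> \<eta> \<in> dual scale \<Longrightarrow> \<xi> - \<eta> \<in> dual scale"
  by (simp add: dual_iff algebra_simps)

lemma tensor2_diff:
  assumes t: "t \<in> tensor2_space scale" and \<xi>: "\<xi> \<in> dual scale" and \<xi>': "\<xi>' \<in> dual scale"
    and \<eta>: "\<eta> \<in> dual scale"
  shows "t (\<xi> - \<xi>') \<eta> = t \<xi> \<eta> - t \<xi>' \<eta>" "t \<eta> (\<xi> - \<xi>') = t \<eta> \<xi> - t \<eta> \<xi>'"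
  using tensor2_add[OF t dual_diff[OF \<xi> \<xi>'] \<xi>' \<eta>] by simp_all

lemma tensor2_zero:
  assumes t: "t \<in> tensor2_space scale"
  shows "t (\<lambda>_. 0) \<eta> = 0" "t \<eta> (\<lambda>_. 0) = 0"
  using tensor2_scale[OF t dual_zero, of \<eta> 0] tensor2_outside[OF t, of "\<lambda>_. 0" \<eta>]
    tensor2_outside[OF t, of \<eta> "\<lambda>_. 0"]
  by (cases "\<eta> \<in> dual scale"; simp)+

lemma tmap_in_tensor2_space:
  assumes "t \<in> tensor2_space scale"
    and "Vector_Spaces.linear scale scale f" and "Vector_Spaces.linear scale scale g"
  shows "tmap scale f g t \<in> tensor2_space scale"
proof -
  have comp: "(\<xi> + \<xi>') \<circ> h = (\<xi> \<circ> h) + (\<xi>' \<circ> h)" "(\<lambda>x. c * \<xi> x) \<circ> h = (\<lambda>x. c * (\<xi> \<circ> h) x)"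
    for \<xi> \<xi>' :: "'a \<Rightarrow> 'k" and h :: "'a \<Rightarrow> 'a" and c
    by (simp_all add: fun_eq_iff)
  have "\<xi> \<circ> f \<in> dual scale" "\<xi> \<circ> g \<in> dual scale" if "\<xi> \<in> dual scale" for \<xi>
    using assms(2,3) that by (simp_all add: dual_compose)
  then show ?thesis
    unfolding tensor2_iff[of "tmap scale f g t"] bilinear_on_dual_def
    by (simp add: tmap_def dual_add dual_scale comp tensor2_add[OF assms(1)]
        tensor2_scale[OF assms(1)] del: comp_apply)
qed

lemma tensor2_space_add:
  "s \<in> tensor2_space scale \<Longrightarrow> t \<in> tensor2_space scale \<Longrightarrow> s + t \<in> tensor2_space scale"
  using module.span_add[OF vector_space_scale2[unfolded vector_space_def, folded module_def]]
  unfolding tensor2_space_def by blast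

end

section \<open>The commutator Lie algebra and the coboundary of a tensor\<close>

context pre_lie_algebra
begin

definition lie :: "'a \<Rightarrow> 'a \<Rightarrow> 'a" where
  "lie x y = x \<odot> y - y \<odot> x"

lemma mul_add_left: "(x + y) \<odot> z = x \<odot> z + y \<odot> z"
  and mul_add_right: "x \<odot> (y + z) = x \<odot> y + x \<odot> z"
  and mul_scale_left: "scale c x \<odot> y = scale c (x \<odot> y)"
  and mul_scale_right: "x \<odot> scale c y = scale c (x \<odot> y)"
  using mul_bilinear by (simp_all add: bilinear_map_def Vector_Spaces.linear_iff)

lemma mul_diff_left: "(x - y) \<odot> z = x \<odot> z - y \<odot> z"
  using mul_add_left[of "x - y" y z] by (simp add: algebra_simps)

lemma mul_diff_right: "x \<odot> (y - z) = x \<odot> y - x \<odot> z"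
  using mul_add_right[of x "y - z" z] by (simp add: algebra_simps)

lemma mul_minus_left: "(- x) \<odot> y = - (x \<odot> y)"
  using mul_diff_left[of 0 x y] mul_diff_left[of 0 0 y] by simp

lemma mul_minus_right: "x \<odot> (- y) = - (x \<odot> y)"
  using mul_diff_right[of x 0 y] mul_diff_right[of x 0 0] by simp

lemmas mul_distribs = mul_add_left mul_add_right mul_diff_left mul_diff_right

lemma Lmul_linear: "Vector_Spaces.linear scale scale (Lmul mul x)"
  and ad_linear: "Vector_Spaces.linear scale scale (Lmul mul x - Rmul mul x)"
  using vector_space_axioms
  by (simp_all add: Vector_Spaces.linear_iff Lmul_def Rmul_def mul_distribs
      mul_scale_left mul_scale_right scale_right_diff_distrib)

lemma lie_distribs:
  "lie (x + y) z = lie x z + lie y z" "lie z (x + y) = lie z x + lie z y"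
  "lie (x - y) z = lie x z - lie y z" "lie z (x - y) = lie z x - lie z y"
  by (simp_all add: lie_def mul_distribs)

text \<open>Left symmetry makes the commutator a Lie bracket. The form chosen, bracketing on the
  right as a derivation, is the one that \<open>coprod_product\<close> expands with.\<close>

lemma jacobi: "lie (lie x y) z = lie (lie x z) y + lie x (lie y z)"
proof -
  have "a \<odot> (b \<odot> c) = b \<odot> (a \<odot> c) + (a \<odot> b) \<odot> c - (b \<odot> a) \<odot> c" for a b c
    using pre_lie[of a b c] by (simp add: algebra_simps)
  from this[of x y z] this[of y z x] this[of z x y] show ?thesis
    by (simp add: lie_def mul_distribs)
qed

lemma coboundary_in_tensor2_space:
  "r \<in> tensor2_space scale \<Longrightarrow> coboundary scale mul r x \<in> tensor2_space scale"
  unfolding coboundary_def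
  by (intro tensor2_space_add tmap_in_tensor2_space Lmul_linear ad_linear linear_id)

lemma coboundary_apply:
  "\<xi> \<in> dual scale \<Longrightarrow> \<eta> \<in> dual scale \<Longrightarrow>
    coboundary scale mul r x \<xi> \<eta> = r (\<xi> \<circ> Lmul mul x) \<eta> + r \<xi> (\<eta> \<circ> (Lmul mul x - Rmul mul x))"
  by (simp add: coboundary_def tmap_def)

text \<open>Left multiplication and the adjoint action are both representations of the commutator
  Lie algebra, hence so is their tensor product, and a coboundary of any \<open>r\<close> is a
  cocycle for it.\<close>

lemma coboundary_commutator:
  assumes r: "r \<in> tensor2_space scale"
  defines "\<Delta> \<equiv> coboundary scale mul r"
  shows "\<Delta> (x \<odot> y - y \<odot> x) =
         (tmap scale (Lmul mul x) id (\<Delta> y) + tmap scale id (Lmul mul x - Rmul mul x) (\<Delta> y))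
       - (tmap scale (Lmul mul y) id (\<Delta> x) + tmap scale id (Lmul mul y - Rmul mul y) (\<Delta> x))"
proof (rule tensor2_eqI, goal_cases)
  case (1 \<xi> \<eta>)
  then show ?case by (auto simp: \<Delta>_def coboundary_def tmap_def)
next
  case (2 \<xi> \<eta>)
  let ?ad = "\<lambda>x. Lmul mul x - Rmul mul x"
  have L: "\<zeta> \<circ> Lmul mul z \<in> dual scale" and ad: "\<zeta> \<circ> ?ad z \<in> dual scale"
    if "\<zeta> \<in> dual scale" for \<zeta> z
    using that by (simp_all add: dual_compose Lmul_linear ad_linear)
  have diff: "\<zeta> (u - v) = \<zeta> u - \<zeta> v" if "\<zeta> \<in> dual scale" for \<zeta> u v
    using that by (metis add_diff_cancel diff_add_cancel dual_iff)
  have "\<xi> \<circ> Lmul mul (x \<odot> y - y \<odot> x) =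
      ((\<xi> \<circ> Lmul mul x) \<circ> Lmul mul y) - ((\<xi> \<circ> Lmul mul y) \<circ> Lmul mul x)"
  proof
    fix z
    have "(x \<odot> y - y \<odot> x) \<odot> z = x \<odot> (y \<odot> z) - y \<odot> (x \<odot> z)"
      using pre_lie[of x y z] by (simp add: mul_distribs algebra_simps)
    then show "(\<xi> \<circ> Lmul mul (x \<odot> y - y \<odot> x)) z =
        (((\<xi> \<circ> Lmul mul x) \<circ> Lmul mul y) - ((\<xi> \<circ> Lmul mul y) \<circ> Lmul mul x)) z"
      using 2(1) by (simp add: Lmul_def diff[symmetric])
  qed
  moreover have "\<eta> \<circ> ?ad (x \<odot> y - y \<odot> x) =
      ((\<eta> \<circ> ?ad x) \<circ> ?ad y) - ((\<eta> \<circ> ?ad y) \<circ> ?ad x)"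
  proof
    fix z
    have "lie (lie x y) z = lie x (lie y z) - lie y (lie x z)"
      using jacobi[of x y z] by (simp add: lie_def mul_distribs)
    then show "(\<eta> \<circ> ?ad (x \<odot> y - y \<odot> x)) z = (((\<eta> \<circ> ?ad x) \<circ> ?ad y) - ((\<eta> \<circ> ?ad y) \<circ> ?ad x)) z"
      using 2(2) by (simp add: Lmul_def Rmul_def diff[symmetric] lie_def)
  qed
  \<comment> \<open>The mixed terms, with \<open>Lmul\<close> in one slot and the adjoint action in
    the other, are symmetric in \<open>x\<close> and \<open>y\<close> and cancel.\<close>
  ultimately show ?case
    using 2 by (simp add: \<Delta>_def coboundary_apply tmap_def L ad tensor2_diff[OF r])
qed

end

section \<open>Adjoints of multiplication operators for an invariant form\<close>

context quadratic_pre_lie_algebra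
begin

lemma form_add_right: "\<omega> z (x + y) = \<omega> z x + \<omega> z y"
  and form_scale_right: "\<omega> z (scale c x) = c * \<omega> z x"
  using form_in_dual[of z] by (simp_all add: dual_iff)

lemma form_diff_left: "\<omega> (x - y) z = \<omega> x z - \<omega> y z"
  using form_add_left[of "x - y" y z] by simp

lemma form_diff_right: "\<omega> z (x - y) = \<omega> z x - \<omega> z y"
  using form_add_right[of z "x - y" y] by simp

lemma form_zero_left: "\<omega> 0 x = 0"
  using form_diff_left[of 0 0 x] by simp

lemma form_minus_left: "\<omega> (- x) z = - \<omega> x z"
  using form_diff_left[of 0 x z] by (simp add: form_zero_left)

lemma form_minus_right: "\<omega> z (- x) = - \<omega> z x"
  using form_diff_right[of z 0 x] form_diff_right[of z 0 0] by simp

lemmas form_distribs = form_add_left form_add_right form_diff_left form_diff_right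
  form_minus_left form_minus_right

lemma form_eqI: "\<omega> x = \<omega> y \<Longrightarrow> x = y"
  by (metis J_form_form)

lemma form_eqI_right: "(\<And>a. \<omega> a x = \<omega> a y) \<Longrightarrow> x = y"
  by (rule form_eqI, rule ext) (metis form_skew)

lemma dual_cases:
  assumes "\<xi> \<in> dual scale" obtains a where "\<xi> = \<omega> a"
  using J_form[OF assms] by metis

text \<open>Invariance read as an adjoint: left multiplication by \<open>x\<close> goes over to
  minus the bracket with \<open>x\<close>. The lemmas after it move further operators across the
  form.\<close>

lemma form_mul_left: "\<omega> (x \<odot> y) z = - \<omega> y (lie x z)"
  using form_invariant[of x y z] by (simp add: lie_def eq_neg_iff_add_eq_0)

lemma form_mul_right: "\<omega> a (x \<odot> y) = \<omega> (lie a x) y"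
  by (metis form_mul_left form_skew form_minus_left lie_def minus_diff_eq add.inverse_inverse)

lemma form_lie_right: "\<omega> a (lie x y) = - \<omega> (x \<odot> a) y"
  by (simp add: form_mul_left)

lemma form_comp_Lmul: "\<omega> a \<circ> Lmul mul x = \<omega> (lie a x)"
  by (simp add: fun_eq_iff Lmul_def form_mul_right)

lemma form_comp_ad: "\<omega> a \<circ> (Lmul mul x - Rmul mul x) = \<omega> (- (x \<odot> a))"
  by (simp add: fun_eq_iff Lmul_def Rmul_def form_minus_left flip: lie_def form_lie_right)

text \<open>Right multiplication is left multiplication minus the bracket. Each of these is minus
  the adjoint of the other, so their difference is self-adjoint.\<close>

lemma form_comp_Rmul: "\<omega> a \<circ> Rmul mul x = \<omega> (a \<odot> x)"
proof
  fix y
  have "\<omega> a (y \<odot> x) = \<omega> a (x \<odot> y) - \<omega> a (lie x y)"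
    by (simp add: lie_def form_diff_right)
  also have "\<dots> = \<omega> (lie a x + x \<odot> a) y"
    by (simp add: form_lie_right form_mul_right form_add_left)
  finally show "(\<omega> a \<circ> Rmul mul x) y = \<omega> (a \<odot> x) y"
    by (simp add: Rmul_def lie_def)
qed

lemma tensor2_eq_formI:
  assumes "\<And>\<xi> \<eta>. \<xi> \<notin> dual scale \<or> \<eta> \<notin> dual scale \<Longrightarrow> s \<xi> \<eta> = t \<xi> \<eta>"
    and "\<And>a b. s (\<omega> a) (\<omega> b) = t (\<omega> a) (\<omega> b)"
  shows "s = (t :: ('a, 'k) tensor2)"
  using assms by (intro tensor2_eqI) (auto elim!: dual_cases)

end

section \<open>The descendent product and the bialgebra obtained from it\<close>

context quadratic_rota_baxter_pre_lie_algebra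
begin

text \<open>This is \<open>r_plus\<close> transported from the dual to the algebra along
  \<open>\<omega>\<close>.\<close>

definition Q :: "'a \<Rightarrow> 'a" where
  "Q x = scale (1 / wt) (B x + scale wt x)"

definition star :: "'a \<Rightarrow> 'a \<Rightarrow> 'a" (infixl \<open>\<star>\<close> 70) where
  "a \<star> b = Q a \<odot> b + a \<odot> Q b - a \<odot> b"

abbreviation coprod :: "'a \<Rightarrow> ('a, 'k) tensor2" where
  "coprod \<equiv> coboundary scale mul (r_form scale B \<omega> wt)"

lemma B_add: "B (x + y) = B x + B y"
  and B_scale: "B (scale c x) = scale c (B x)"
  using B_linear by (simp_all add: Vector_Spaces.linear_iff)

lemma B_diff: "B (x - y) = B x - B y"
  using B_add[of "x - y" y] by (simp add: algebra_simps)

lemma Q_diff: "Q (x - y) = Q x - Q y"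
  by (simp add: Q_def B_diff algebra_simps)

lemma Q_minus: "Q (- x) = - Q x"
  using Q_diff[of 0 x] Q_diff[of 0 0] by simp

lemma r_form_form: "r_form scale B \<omega> wt (\<omega> a) (\<omega> b) = \<omega> b (Q a)"
  by (simp add: r_form_def form_in_dual r_plus_def J_form_form Q_def)

lemma star_minus_left: "- a \<star> b = - (a \<star> b)"
  and star_minus_right: "a \<star> - b = - (a \<star> b)"
  by (simp_all add: star_def Q_minus mul_minus_left mul_minus_right)

context
  assumes wt: "wt \<noteq> 0"
begin

lemma Q_eq: "Q x = scale (1 / wt) (B x) + x"
  using wt by (simp add: Q_def scale_right_distrib)

text \<open>The Rota-Baxter identity of weight -1 for \<open>Q\<close>, inherited from
  \<open>B\<close> by rescaling and shifting by the identity.\<close>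

lemma Q_star: "Q (a \<star> b) = Q a \<odot> Q b"
proof -
  have "a \<star> b = scale (1 / wt) (B a \<odot> b + a \<odot> B b + scale wt (a \<odot> b))"
    using wt by (simp add: star_def Q_eq mul_distribs mul_scale_left mul_scale_right algebra_simps)
  then have "B (a \<star> b) = scale (1 / wt) (B a \<odot> B b)"
    by (simp add: B_scale flip: rota_baxter)
  then show ?thesis
    using wt by (simp add: Q_eq star_def mul_distribs mul_scale_left mul_scale_right algebra_simps)
qed

lemma form_Q: "\<omega> (Q x) y = \<omega> x y - \<omega> x (Q y)"
proof -
  have "\<omega> (B x) y = - \<omega> x (B y) - wt * \<omega> x y"
    using form_rota_baxter[of x y] by (simp add: algebra_simps eq_neg_iff_add_eq_0)
  then show ?thesis
    using wt by (simp add: Q_eq form_distribs form_scale_left form_scale_right field_simps)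
qed

lemma star_pre_lie: "(x \<star> y) \<star> z - x \<star> (y \<star> z) = (y \<star> x) \<star> z - y \<star> (x \<star> z)"
proof -
  define as where "as a b c = (a \<odot> b) \<odot> c - a \<odot> (b \<odot> c)" for a b c
  have as: "as a b c = as b a c" for a b c
    using pre_lie by (simp add: as_def)
  \<comment> \<open>\<open>Q_star\<close> resolves \<open>Q\<close> of a product, so the associator
    of \<open>\<star>\<close> becomes a sum of associators of \<open>\<odot>\<close>. Under exchange
    of \<open>a\<close> and \<open>b\<close> the two middle terms trade places and the outer ones
    are fixed, by left symmetry.\<close>
  have assoc: "(a \<star> b) \<star> z - a \<star> (b \<star> z) =
      as (Q a) (Q b) z + as (Q a) b (Q z - z) + as a (Q b) (Q z - z) - as a b (Q z - z)" for a b
    unfolding star_def[of "a \<star> b"] star_def[of a "b \<star> z"] Q_star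
    by (simp add: star_def as_def mul_distribs algebra_simps)
  then show ?thesis
    unfolding assoc as[of "Q x" "Q y"] as[of "Q x" y] as[of x "Q y"] as[of x y] by simp
qed

text \<open>All later facts on the coproduct are read off from this formula. It follows from
  invariance and the adjoint \<open>id - Q\<close> of \<open>Q\<close>; the identity part produces
  the summand \<open>- a \<odot> b\<close> of \<open>\<star>\<close>.\<close>

lemma coprod_form: "coprod x (\<omega> a) (\<omega> b) = \<omega> (a \<star> b) x"
proof -
  have "coprod x (\<omega> a) (\<omega> b) = \<omega> b (Q (lie a x)) - \<omega> (x \<odot> b) (Q a)"
    by (simp add: coboundary_apply form_in_dual form_comp_Lmul form_comp_ad r_form_form
        form_minus_left)
  also have "\<omega> b (Q (lie a x)) = \<omega> (b - Q b) (lie a x)"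
    by (simp add: form_Q form_diff_left)
  also have "\<dots> = - \<omega> (a \<odot> (b - Q b)) x"
    by (simp add: form_lie_right)
  also have "\<omega> (x \<odot> b) (Q a) = - \<omega> (Q a \<odot> b) x"
    by (simp add: form_mul_left lie_def form_diff_right)
  finally show ?thesis
    by (simp add: star_def form_distribs mul_distribs)
qed

lemma coprod_outside: "\<xi> \<notin> dual scale \<or> \<eta> \<notin> dual scale \<Longrightarrow> coprod x \<xi> \<eta> = 0"
  by (rule tensor2_outside[OF coboundary_in_tensor2_space[OF r_form_tensor]])

lemma coprod_linear: "Vector_Spaces.linear scale scale2 coprod"
proof -
  have "coprod (x + y) = coprod x + coprod y" for x y
    by (rule tensor2_eq_formI) (simp_all add: coprod_outside coprod_form form_distribs)
  moreover have "coprod (scale c x) = scale2 c (coprod x)" for c x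
    by (rule tensor2_eq_formI) (simp_all add: coprod_outside coprod_form form_scale_right scale2_def)
  ultimately show ?thesis
    using vector_space_axioms vector_space_scale2 by (simp add: Vector_Spaces.linear_iff)
qed

lemma coprod_co_pre_lie:
  "tmap_left coprod (coprod x) - tmap_right coprod (coprod x) =
   flip12 (tmap_left coprod (coprod x) - tmap_right coprod (coprod x))"
proof (intro ext)
  fix \<xi> \<eta> \<zeta> :: "'a \<Rightarrow> 'k"
  \<comment> \<open>With this, the two iterated coproducts evaluate to
    \<open>(a \<star> b) \<star> c\<close> and \<open>a \<star> (b \<star> c)\<close> paired with
    \<open>x\<close>.\<close>
  have fn: "(\<lambda>y. coprod y (\<omega> a) (\<omega> b)) = \<omega> (a \<star> b)" for a b
    by (simp add: coprod_form fun_eq_iff)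
  note z = tensor2_zero[OF coboundary_in_tensor2_space[OF r_form_tensor]]
  show "(tmap_left coprod (coprod x) - tmap_right coprod (coprod x)) \<xi> \<eta> \<zeta> =
   flip12 (tmap_left coprod (coprod x) - tmap_right coprod (coprod x)) \<xi> \<eta> \<zeta>"
  proof (cases "\<xi> \<in> dual scale \<and> \<eta> \<in> dual scale \<and> \<zeta> \<in> dual scale")
    case True
    then obtain a b c where abc: "\<xi> = \<omega> a" "\<eta> = \<omega> b" "\<zeta> = \<omega> c"
      by (metis J_form)
    show ?thesis
      using star_pre_lie[of a b c]
      by (simp add: abc tmap_left_def tmap_right_def flip12_def fn coprod_form flip: form_diff_left)
  next
    \<comment> \<open>The inner coproduct may become the zero functional, which does lie in the
      dual; \<open>tensor2_zero\<close> handles it.\<close>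
    case False
    then show ?thesis
      by (auto simp: tmap_left_def tmap_right_def flip12_def coprod_outside z)
  qed
qed

lemma coprod_product:
  "coprod (x \<odot> y) - flip2 (coprod (x \<odot> y)) =
     (let t = tmap scale id (Rmul mul y) (coprod x)
            + (tmap scale (Lmul mul x) id (coprod y) + tmap scale id (Lmul mul x) (coprod y))
      in t - flip2 t)"
  unfolding Let_def
proof (rule tensor2_eq_formI, goal_cases)
  case (1 \<xi> \<eta>)
  then show ?case by (auto simp: coprod_outside tmap_def flip2_def)
next
  case (2 a b)
  \<comment> \<open>The defect of \<open>Q\<close> in commuting with the bracket by
    \<open>x\<close>. It lets the \<open>Rmul\<close> term be written as a pairing with
    \<open>y\<close>, so that the claim reduces to an identity in the algebra.\<close>
  define u where "u c = lie (Q c) x - Q (lie c x)" for c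
  have *: "\<omega> (c \<star> (d \<odot> y)) x = \<omega> (lie (u c) d) y" for c d
  proof -
    have "\<omega> (c \<star> (d \<odot> y)) x
        = - \<omega> (d \<odot> y) (lie (Q c) x) - \<omega> (Q (d \<odot> y) - d \<odot> y) (lie c x)"
      unfolding star_def form_distribs form_mul_left[of "Q c"] form_mul_left[of c] by simp
    also have "\<dots> = - \<omega> (d \<odot> y) (u c)"
      by (simp add: form_Q form_distribs u_def)
    also have "\<dots> = \<omega> (lie (u c) d) y"
      by (metis form_mul_right form_skew)
    finally show ?thesis .
  qed
  have star_lie: "c \<star> d - d \<star> c = lie (Q c) d + lie c (Q d) - lie c d" for c d
    by (simp add: star_def lie_def)
  \<comment> \<open>The bracket with \<open>x\<close> is a derivation of each summand in
    \<open>star_lie\<close>; pulling it through \<open>Q\<close> leaves the defects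
    \<open>u a\<close> and \<open>u b\<close>.\<close>
  have "lie (a \<star> b - b \<star> a) x =
     (lie a x \<star> b - b \<star> lie a x) + (a \<star> lie b x - lie b x \<star> a) + lie (u a) b - lie (u b) a"
    unfolding star_lie
    by (simp add: u_def lie_distribs jacobi[of "Q a" b x] jacobi[of a "Q b" x] jacobi[of a b x])
       (simp add: lie_def)
  from arg_cong[OF this, of "\<lambda>z. \<omega> z y"] show ?case
    by (simp add: tmap_def flip2_def form_in_dual form_comp_Lmul form_comp_Rmul coprod_form
        form_mul_right * form_distribs lie_distribs algebra_simps)
qed

lemma coprod_bialgebra: "pre_lie_bialgebra scale mul coprod"
proof -
  have "pre_lie_coalgebra scale coprod"
    by (intro pre_lie_coalgebra.intro pre_lie_coalgebra_axioms.intro fd_vector_space_axioms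
        coboundary_in_tensor2_space r_form_tensor coprod_linear coprod_co_pre_lie)
  then show ?thesis
    by (intro pre_lie_bialgebra.intro pre_lie_bialgebra_axioms.intro pre_lie_algebra_axioms
        coboundary_commutator r_form_tensor coprod_product)
qed

end

end

section \<open>Averaging operators and their compatibility with the coproduct\<close>

context averaging_operator_quadratic_rota_baxter
begin

lemma P_add: "P (x + y) = P x + P y"
  and P_scale: "P (scale c x) = scale c (P x)"
  using P_linear by (simp_all add: Vector_Spaces.linear_iff)

lemma P_diff: "P (x - y) = P x - P y"
  using P_add[of "x - y" y] by (simp add: algebra_simps)

lemma P_minus: "P (- x) = - P x"
  using P_diff[of 0 x] P_diff[of 0 0] by simp

context
  assumes wt: "wt \<noteq> 0"
begin

lemma form_P: "\<omega> (P a) b = - \<omega> a (P b)"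
  and B_P: "B (P x) = P (B x)"
proof -
  let ?P' = "form_adjoint \<omega> P"
  have B': "\<omega> (B x) y = - \<omega> x (B y + scale wt y)" for x y
    using form_rota_baxter[of x y]
    by (simp add: form_distribs form_scale_right algebra_simps eq_neg_iff_add_eq_0)
  have adj: "\<omega> (P x) y = \<omega> x (?P' y)" for x y
    by (rule form_adjoint[OF P_linear])
  have adj': "\<omega> (?P' x) y = \<omega> x (P y)" for x y
    by (metis adj form_skew)
  have BP': "B (?P' x) = - P (B x)" for x
    using B_adjoint by (simp add: fun_eq_iff)
  have P': "?P' x = - P x" for x
  proof (rule form_eqI_right)
    fix a
    \<comment> \<open>Both sides of \<open>BP'\<close> are moved across the form. The
      \<open>B\<close> terms cancel by \<open>BP'\<close> again; the shifts by \<open>wt\<close> in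
      \<open>B'\<close> survive, and dividing by \<open>wt\<close> identifies \<open>?P'\<close>
      with \<open>- P\<close>.\<close>
    have "\<omega> (B (?P' a)) x = - \<omega> a (P (B x)) - wt * \<omega> a (P x)"
      by (simp add: B' adj' P_add P_scale form_distribs form_scale_right)
    moreover have "\<omega> (- P (B a)) x = \<omega> a (B (?P' x)) + wt * \<omega> a (?P' x)"
      by (simp add: B' adj form_distribs form_scale_right)
    ultimately have "wt * \<omega> a (?P' x) = wt * \<omega> a (- P x)"
      by (simp add: BP' form_distribs)
    then show "\<omega> a (?P' x) = \<omega> a (- P x)"
      using wt by simp
  qed
  show "\<omega> (P a) b = - \<omega> a (P b)"
    by (simp add: adj P' form_minus_right)
  show "B (P x) = P (B x)"
    using BP'[of x] B_diff[of 0 "P x"] B_diff[of 0 0] by (simp add: P')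
qed

lemma Q_P: "Q (P x) = P (Q x)"
  by (simp add: Q_def P_add P_scale B_P)

text \<open>
  Moving \<open>P\<close> around the invariant form reverses the sign of \<open>\<omega> (P x \<odot> P y) z\<close>.  Without this
  vanishing, the condition \<open>S (P x \<odot> y) = S (x \<odot> S y)\<close> would fail for \<open>S = - P\<close>.
\<close>

lemma P_mul_P: "P x \<odot> P y = 0"
proof (rule form_nondegenerate)
  fix z
  have "\<omega> (P x \<odot> P y) z = \<omega> (P y) (lie x (P z))"
    by (simp add: averaging_right form_P form_mul_left)
  also have "\<dots> = - \<omega> y (lie (P x) (P z))"
    by (simp add: form_P lie_def P_diff flip: averaging_left averaging_right)
  also have "\<dots> = - \<omega> (P x \<odot> P y) z"
    by (simp add: averaging_left form_P form_mul_left)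
  finally show "\<omega> (P x \<odot> P y) z = 0"
    by simp
qed

lemma P_mul_left: "P (P x \<odot> y) = 0"
  and P_mul_right: "P (x \<odot> P y) = 0"
  by (simp_all add: P_mul_P flip: averaging_left averaging_right)

text \<open>Since \<open>Q\<close> commutes with \<open>P\<close>, every summand of
  \<open>\<star>\<close> yields a product already known to vanish. Through
  \<open>coprod_form\<close> these are the duals of the co-averaging conditions.\<close>

lemma star_P_P: "P x \<star> P y = 0"
  and P_star_left: "P (P x \<star> y) = 0"
  and P_star_right: "P (x \<star> P y) = 0"
  by (simp_all add: star_def P_add P_diff Q_P P_mul_P P_mul_left P_mul_right)

lemma coprod_tmap_eqI:
  assumes "\<And>a b. tmap scale f g (coprod x) (\<omega> a) (\<omega> b) = tmap scale f' g' (coprod y) (\<omega> a) (\<omega> b)"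
  shows "tmap scale f g (coprod x) = tmap scale f' g' (coprod y)"
  by (rule tensor2_eq_formI) (use assms in \<open>auto simp: tmap_def\<close>)

lemma form_comp_P: "\<omega> a \<circ> P = \<omega> (- P a)"
  and form_comp_minus_P: "\<omega> a \<circ> (\<lambda>x. - P x) = \<omega> (P a)"
  by (simp_all add: fun_eq_iff form_P form_distribs)

lemma averaging_bialgebra: "averaging_pre_lie_bialgebra scale mul coprod P (\<lambda>x. - P x)"
proof -
  interpret bialgebra: pre_lie_bialgebra scale mul coprod
    by (rule coprod_bialgebra[OF wt])
  \<comment> \<open>Oriented to move \<open>P\<close> off the argument of the coproduct and onto
    \<open>a \<star> b\<close>, where \<open>P_star_left\<close> and \<open>P_star_right\<close>
    apply.\<close>
  have form_P_right: "\<omega> a (P b) = - \<omega> (P a) b" for a b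
    by (simp add: form_P)
  note eval = tmap_def form_in_dual coprod_form[OF wt] form_comp_P form_comp_minus_P
    star_minus_left star_minus_right form_minus_left form_minus_right form_P_right
    star_P_P P_star_left P_star_right form_zero_left
  show ?thesis
  proof (intro averaging_pre_lie_bialgebra.intro averaging_pre_lie_coalgebra.intro
      averaging_pre_lie_coalgebra_axioms.intro averaging_pre_lie_bialgebra_axioms.intro
      averaging_pre_lie_algebra_axioms bialgebra.pre_lie_coalgebra_axioms
      bialgebra.pre_lie_bialgebra_axioms coprod_tmap_eqI)
    show "Vector_Spaces.linear scale scale (\<lambda>x. - P x)"
      using vector_space_axioms by (simp add: Vector_Spaces.linear_iff P_add P_scale)
  qed (simp_all add: eval mul_minus_left mul_minus_right P_minus P_mul_P P_mul_left P_mul_right)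
qed

end

end

theorem theorem3p18:
  fixes scale :: "'k::field_char_0 \<Rightarrow> 'a::ab_group_add \<Rightarrow> 'a"
    and mul :: "'a \<Rightarrow> 'a \<Rightarrow> 'a"
    and B P :: "'a \<Rightarrow> 'a"
    and \<omega> :: "'a \<Rightarrow> 'a \<Rightarrow> 'k"
    and wt :: 'k
  assumes "quadratic_rota_baxter_pre_lie_algebra scale mul B \<omega> wt"
    and "wt \<noteq> 0"
    and "averaging_operator_quadratic_rota_baxter scale mul B \<omega> wt P"
  shows "averaging_pre_lie_bialgebra scale mul
           (coboundary scale mul (r_form scale B \<omega> wt)) P (\<lambda>x. - P x)"
  by (rule averaging_operator_quadratic_rota_baxter.averaging_bialgebra[OF assms(3,2)])

end
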